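(* There exists a fadelian ring which is neither right Ore nor left Ore.
   Context: All rings are nontrivial ($1\neq 0$), unital, associative, and not assumed commutative. A ring $R$ is fadelian if for every $x\in R$ and every nonzero $a\in R$ there exist $b,c\in R$ such that $x=ab+ca$. A ring is integral if it has no zero divisors ($xy=0$ implies $x=0$ or $y=0$); every fadelian ring is integral. An integral ring is right (resp. left) Ore if any two nonzero right (resp. left) ideals have a nonzero intersection. *)

theory Defs
  imports "HOL-Algebra.Ideal"
begin

locale nontrivial_ring = ring R for R (structure) +
  assumes one_not_zero: "\<one> \<noteq> \<zero>"

(* The locale domain of HOL-Algebra is commutative, hence a separate noncommutative notion. *)
locale integral_ring = nontrivial_ring R for R (structure) +
  assumes integral: "\<lbrakk> x \<otimes> y = \<zero>; x \<in> carrier R; y \<in> carrier R \<rbrakk> \<Longrightarrow> x = \<zero> \<or> y = \<zero>"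

locale fadelian_ring = nontrivial_ring R for R (structure) +
  assumes fadelian: "\<lbrakk> x \<in> carrier R; a \<in> carrier R; a \<noteq> \<zero> \<rbrakk>
    \<Longrightarrow> \<exists>b\<in>carrier R. \<exists>c\<in>carrier R. x = a \<otimes> b \<oplus> c \<otimes> a"

locale right_ideal = additive_subgroup I R + ring R for I and R (structure) +
  assumes r_closed: "\<lbrakk> a \<in> I; x \<in> carrier R \<rbrakk> \<Longrightarrow> a \<otimes> x \<in> I"

locale left_ideal = additive_subgroup I R + ring R for I and R (structure) +
  assumes l_closed: "\<lbrakk> a \<in> I; x \<in> carrier R \<rbrakk> \<Longrightarrow> x \<otimes> a \<in> I"

(* The Ore conditions are meant for integral rings. Integrality is deliberately not a conjunct
   here, so that the negation of right_ore or left_ore always asserts the existence of two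
   nonzero one-sided ideals with zero intersection. By fadelian_imp_integral below,
   every fadelian ring is integral. *)
definition right_ore :: "('a, 'm) ring_scheme \<Rightarrow> bool" where
  "right_ore R \<longleftrightarrow> (\<forall>I J. right_ideal I R \<and> right_ideal J R
     \<and> I \<noteq> {\<zero>\<^bsub>R\<^esub>} \<and> J \<noteq> {\<zero>\<^bsub>R\<^esub>} \<longrightarrow> I \<inter> J \<noteq> {\<zero>\<^bsub>R\<^esub>})"

definition left_ore :: "('a, 'm) ring_scheme \<Rightarrow> bool" where
  "left_ore R \<longleftrightarrow> (\<forall>I J. left_ideal I R \<and> left_ideal J R
     \<and> I \<noteq> {\<zero>\<^bsub>R\<^esub>} \<and> J \<noteq> {\<zero>\<^bsub>R\<^esub>} \<longrightarrow> I \<inter> J \<noteq> {\<zero>\<^bsub>R\<^esub>})"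

lemma (in fadelian_ring) square_zero:
  assumes a: "a \<in> carrier R" and sq: "a \<otimes> a = \<zero>"
  shows "a = \<zero>"
proof (rule ccontr)
  assume nz: "a \<noteq> \<zero>"
  obtain b c where bc: "b \<in> carrier R" "c \<in> carrier R" "\<one> = a \<otimes> b \<oplus> c \<otimes> a"
    using fadelian[OF one_closed a nz] by blast
  have aca: "a \<otimes> x \<otimes> a = \<zero>" if x: "x \<in> carrier R" for x
  proof -
    obtain d e where de: "d \<in> carrier R" "e \<in> carrier R" "x = a \<otimes> d \<oplus> e \<otimes> a"
      using fadelian[OF x a nz] by blast
    have "a \<otimes> x \<otimes> a = (a \<otimes> a) \<otimes> d \<otimes> a \<oplus> a \<otimes> e \<otimes> (a \<otimes> a)"
      using a de by (simp add: l_distr r_distr m_assoc)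
    then show ?thesis using a de sq by simp
  qed
  have "a = a \<otimes> (a \<otimes> b \<oplus> c \<otimes> a)"
    using a bc(3) by (metis r_one)
  also have "\<dots> = (a \<otimes> a) \<otimes> b \<oplus> a \<otimes> c \<otimes> a"
    using a bc(1,2) by (simp add: r_distr m_assoc)
  also have "\<dots> = \<zero>"
    using a bc(1,2) sq aca by simp
  finally show False using nz by simp
qed

lemma (in fadelian_ring) mult_zero_swap:
  assumes "x \<in> carrier R" "y \<in> carrier R" "x \<otimes> y = \<zero>"
  shows "y \<otimes> x = \<zero>"
proof (rule square_zero)
  have "(y \<otimes> x) \<otimes> (y \<otimes> x) = y \<otimes> (x \<otimes> y) \<otimes> x"
    using assms(1,2) by (simp add: m_assoc)
  then show "(y \<otimes> x) \<otimes> (y \<otimes> x) = \<zero>" using assms by simp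
qed (use assms in simp)

lemma (in fadelian_ring) fadelian_imp_integral: "integral_ring R"
proof unfold_locales
  fix x y assume xy: "x \<otimes> y = \<zero>" "x \<in> carrier R" "y \<in> carrier R"
  show "x = \<zero> \<or> y = \<zero>"
  proof (rule disjCI)
    assume "y \<noteq> \<zero>"
    then obtain b c where bc: "b \<in> carrier R" "c \<in> carrier R" "\<one> = y \<otimes> b \<oplus> c \<otimes> y"
      using fadelian[OF one_closed xy(3)] by blast
    have yx: "y \<otimes> x = \<zero>" using mult_zero_swap xy by blast
    have "x \<otimes> (c \<otimes> y) = \<zero>"
    proof -
      have "(c \<otimes> y) \<otimes> x = \<zero>" using xy bc yx by (simp add: m_assoc)
      then show ?thesis using mult_zero_swap xy bc by simp
    qed
    moreover have "x \<otimes> (y \<otimes> b) = \<zero>"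
      using xy bc(1) by (simp flip: m_assoc)
    moreover have "x = x \<otimes> (y \<otimes> b \<oplus> c \<otimes> y)"
      using xy(2) bc(3) by (metis r_one)
    ultimately show "x = \<zero>" using xy(2,3) bc(1,2) by (simp add: r_distr)
  qed
qed

end

theory Submission
  imports Defs "HOL-Computational_Algebra.Polynomial" "HOL-Library.Z2" "HOL-Library.Countable"
    "HOL-Library.Discrete_Functions"
begin

text \<open>
The idea is to adjoin solutions of the equations \<open>x = a b + c a\<close> one after the other, so freely
that leading terms are never spoilt.

Everything happens inside the endomorphism ring of the additive group \<open>V\<close> of polynomials over
the field with two elements. The exponents form an ordered monoid (\<open>\<nat>\<close> with the product \<open>\<star>\<close>): they
stand for binary words, with concatenation as product and the length-lexicographic order as order.
An operator \<open>f\<close> has the \<^emph>\<open>lead\<close> \<open>m\<close> if it takes every nonzero polynomial of degree \<open>d\<close> to one of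
degree \<open>m \<star> d\<close>. Leads are multiplicative. Consider rings of operators in which every nonzero
element has a lead, and this lead is a word over a free alphabet of \<^emph>\<open>letters\<close>. If such a ring
contains \<open>u\<close> and \<open>v\<close> with leads \<open>e e'\<close> and \<open>e' e\<close> for distinct letters \<open>e\<close> and \<open>e'\<close>, then
a nonzero common multiple \<open>u r = v s\<close> would have a lead that starts both with \<open>e e'\<close> and with
\<open>e' e\<close>, and \<open>r u = s v\<close> one that ends with both. So such a ring is neither right nor left Ore
(\<open>independent_if_leads_swapped\<close>), and this persists in all larger rings of the same kind.

Let \<open>R\<close> be such a ring, \<open>x, a \<in> R\<close>, and let \<open>a \<noteq> 0\<close> have lead \<open>m\<close>. Take a new letter \<open>e\<close> exceeding
the lead of \<open>x\<close>, an operator \<open>E\<close> with lead \<open>e\<close>, and an additive left inverse \<open>q\<close> of \<open>a\<close>, which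
exists because \<open>a\<close> is injective. Put \<open>b = E a\<close> and \<open>c = a E + x q\<close>. In characteristic two,
\<open>a b + c a = a E a + a E a + x q a = x\<close>. The leads of \<open>b\<close> and \<open>c\<close> are \<open>e m\<close> and \<open>m e\<close>, since the term
\<open>x q\<close> is dominated by \<open>a E\<close>. It remains to see that every nonzero element of the ring generated by
\<open>R\<close>, \<open>b\<close> and \<open>c\<close> has a lead. Using \<open>a b = x + c a\<close> one moves multiples of \<open>a\<close> away from the left of
\<open>b\<close>, so the ring is spanned by the normal words \<open>\<beta>\<^sub>0 y\<^sub>1 \<beta>\<^sub>1 \<dots> y\<^sub>d \<beta>\<^sub>d\<close> with \<open>y\<^sub>i \<in> {b, c}\<close>, where the
\<open>\<beta>\<^sub>i\<close> belong to a basis of \<open>R\<close> with distinct leads, and an element in front of \<open>b\<close> does not have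
the lead of a multiple of \<open>a\<close> (\<open>asum_nwords_closed\<close>). The first \<open>e\<close> in the lead of such a word is
preceded by the product of a lead from \<open>R\<close> with \<open>m\<close> if \<open>y\<^sub>1 = c\<close>, but not if \<open>y\<^sub>1 = b\<close>; so \<open>\<beta>\<^sub>0\<close>, \<open>y\<^sub>1\<close> and the
rest can be read off, distinct normal words have distinct leads (\<open>nwords_leads\<close>), and the largest
lead in a sum survives (\<open>lead_asum\<close>). This is the step \<open>adjoin_solution\<close>.

Elements of such a ring are determined by their value at the polynomial \<open>1\<close>, so the rings are
countable, all equations can be treated in a single sequence of steps, and the union of the sequence
can be transported to \<open>\<nat>\<close>.
\<close>

section \<open>The ordered monoid of binary words\<close>

text \<open>
The binary word \<open>w\<close> is represented by the number with binary expansion \<open>1w\<close>, diminished by one.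
Then \<open>0\<close> is the empty word, every natural number is a word, and the usual order of \<open>\<nat>\<close> is the
length-lexicographic one. Degrees of polynomials can thus be read as words.
\<close>

definition wlen :: "nat \<Rightarrow> nat" where
  "wlen n = floor_log (n + 1)"

definition wcat :: "nat \<Rightarrow> nat \<Rightarrow> nat" (infixr "\<star>" 70) where
  "m \<star> n = m * 2 ^ wlen n + n"

lemma wlen_bounds: "2 ^ wlen n \<le> n + 1" "n + 1 < 2 * 2 ^ wlen n"
  unfolding wlen_def by (rule floor_log_exp2_le, simp) (rule floor_log_exp2_gt)

lemma wlen_eqI: "2 ^ k \<le> n + 1 \<Longrightarrow> n + 1 < 2 * 2 ^ k \<Longrightarrow> wlen n = k"
  unfolding wlen_def by (rule floor_log_eqI) auto

lemma wlen_mono: "m \<le> n \<Longrightarrow> wlen m \<le> wlen n"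
  unfolding wlen_def by (rule floor_log_le_iff) simp

lemma wlen_0 [simp]: "wlen 0 = 0"
  by (simp add: wlen_def)

lemma wcat_0 [simp]: "0 \<star> n = n" "n \<star> 0 = n"
  by (simp_all add: wcat_def)

lemma wlen_wcat: "wlen (m \<star> n) = wlen m + wlen n"
proof (rule wlen_eqI)
  let ?a = "2 ^ wlen m :: nat" and ?b = "2 ^ wlen n :: nat"
  have "?a * ?b \<le> (m + 1) * ?b"
    using wlen_bounds(1)[of m] by (intro mult_right_mono) auto
  moreover have "m \<star> n + 1 \<ge> (m + 1) * ?b"
    using wlen_bounds(1)[of n] by (simp add: wcat_def)
  ultimately show "2 ^ (wlen m + wlen n) \<le> m \<star> n + 1"
    by (simp add: power_add)
  have "m + 2 \<le> 2 * ?a"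
    using wlen_bounds(2)[of m] by simp
  then have "(m + 2) * ?b \<le> 2 * ?a * ?b"
    by (rule mult_right_mono) simp
  moreover have "m \<star> n + 1 < (m + 2) * ?b"
    using wlen_bounds(2)[of n] by (simp add: wcat_def)
  ultimately show "m \<star> n + 1 < 2 * 2 ^ (wlen m + wlen n)"
    by (simp add: power_add)
qed

lemma wcat_assoc: "(m \<star> n) \<star> k = m \<star> (n \<star> k)"
  by (simp add: wcat_def[of "m \<star> n"] wcat_def[of m "n \<star> k"] wlen_wcat)
     (simp add: wcat_def power_add algebra_simps)

lemma wcat_less_left: "m < m' \<Longrightarrow> m \<star> n < m' \<star> n"
  by (simp add: wcat_def)

lemma wcat_less_right: "n < n' \<Longrightarrow> m \<star> n < m \<star> n'"
  using wlen_mono[of n n'] by (simp add: wcat_def add_le_less_mono)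

lemma wcat_less_iff [simp]: "m \<star> n < m' \<star> n \<longleftrightarrow> m < m'" "m \<star> n < m \<star> n' \<longleftrightarrow> n < n'"
  by (metis linorder_less_linear order_less_asym wcat_less_left)
     (metis linorder_less_linear order_less_asym wcat_less_right)

lemma wcat_le_iff [simp]: "m \<star> n \<le> m' \<star> n \<longleftrightarrow> m \<le> m'" "m \<star> n \<le> m \<star> n' \<longleftrightarrow> n \<le> n'"
  by (simp_all add: linorder_not_less[symmetric])

lemma wcat_cancel [simp]: "m \<star> n = m' \<star> n \<longleftrightarrow> m = m'" "m \<star> n = m \<star> n' \<longleftrightarrow> n = n'"
  by (simp_all add: order_eq_iff)

text \<open>
The letter \<open>i\<close> is the binary word consisting of \<open>i\<close> ones and a final zero. No letter is a prefix of
another one, so the letters generate a free submonoid, and it contains arbitrarily large letters.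
\<close>

definition letter :: "nat \<Rightarrow> nat" where
  "letter i = 2 ^ (i + 2) - 3"

lemma letter_add_3: "letter i + 3 = 2 ^ (i + 2)"
proof -
  have "1 \<le> (2 :: nat) ^ i" by simp
  moreover have "(2 :: nat) ^ (i + 2) = 4 * 2 ^ i" by simp
  ultimately have "3 \<le> (2 :: nat) ^ (i + 2)" by linarith
  then show ?thesis by (simp add: letter_def)
qed

lemma letter_wcat_inject:
  assumes "letter i \<star> x = letter j \<star> y"
  shows "i = j" "x = y"
proof -
  \<comment> \<open>\<open>t x\<close> is what \<open>letter i \<star> x + 1\<close> lacks to the next power of two. It does not depend on
    \<open>i\<close>, and its size reveals \<open>wlen x\<close>.\<close>
  define t where "t x = 3 * 2 ^ wlen x - (x + 1)" for x :: nat
  have t: "t x + (x + 1) = 3 * 2 ^ wlen x" "2 ^ wlen x < t x" "t x \<le> 2 * 2 ^ wlen x" for x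
    using wlen_bounds[of x] unfolding t_def by linarith+
  have gap: "letter i \<star> x + 1 + t x = 2 * 2 ^ (i + 1 + wlen x)" for i x
  proof -
    have "(letter i + 3) * 2 ^ wlen x = 2 ^ (i + 2) * 2 ^ wlen x"
      by (simp only: letter_add_3)
    then show ?thesis
      using t(1)[of x] by (simp add: wcat_def power_add algebra_simps)
  qed
  have len: "wlen (letter i \<star> x) = i + 1 + wlen x" for i x
  proof (rule wlen_eqI)
    have "2 * 2 ^ wlen x \<le> (2 ^ (i + 1 + wlen x) :: nat)"
      by (simp add: power_add)
    then show "2 ^ (i + 1 + wlen x) \<le> letter i \<star> x + 1"
      using gap[of i x] t(3)[of x] by linarith
    show "letter i \<star> x + 1 < 2 * 2 ^ (i + 1 + wlen x)"
      using gap[of i x] t(2)[of x] by linarith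
  qed
  have s: "i + 1 + wlen x = j + 1 + wlen y"
    using len[of i x] len[of j y] assms by simp
  have eq: "t x = t y"
    using gap[of i x] gap[of j y] assms s by simp
  have "wlen (t x - 2) = wlen x" for x
    using t(2,3)[of x] by (intro wlen_eqI) linarith+
  then have l: "wlen x = wlen y" using eq by metis
  then show "x = y" using t(1)[of x] t(1)[of y] eq by simp
  show "i = j" using s l by simp
qed

definition word :: "nat list \<Rightarrow> nat" where
  "word is = foldr (\<lambda>i n. letter i \<star> n) is 0"

lemma word_Nil [simp]: "word [] = 0" and word_Cons [simp]: "word (i # is) = letter i \<star> word is"
  by (simp_all add: word_def)

lemma word_append: "word (is @ js) = word is \<star> word js"
  by (induction "is") (simp_all add: wcat_assoc)

lemma letter_pos: "0 < letter i"
proof -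
  have "1 \<le> (2 :: nat) ^ i" by simp
  moreover have "(2 :: nat) ^ (i + 2) = 4 * 2 ^ i" by simp
  ultimately show ?thesis using letter_add_3[of i] by linarith
qed

lemma le_letter: "i \<le> letter i"
proof -
  have "i + 3 \<le> 2 ^ (i + 2)" by (induction i) auto
  then show ?thesis using letter_add_3[of i] by linarith
qed

lemma letter_wcat_neq_0: "letter i \<star> n \<noteq> 0"
  using letter_pos[of i] by (simp add: wcat_def)

lemma inj_word: "inj word"
proof (rule injI)
  show "word is = word js \<Longrightarrow> is = js" for "is" js
  proof (induction "is" arbitrary: js)
    case Nil
    then show ?case by (cases js) (auto simp: letter_wcat_neq_0 dest: sym)
  next
    case (Cons i "is")
    then show ?case
      by (cases js) (auto simp: letter_wcat_neq_0 dest: letter_wcat_inject)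
  qed
qed

lemma word_eq_iff [simp]: "word is = word js \<longleftrightarrow> is = js"
  using inj_word by (auto dest: injD)

text \<open>
Words over the letters below \<open>k\<close>: letter \<open>k\<close> is fresh for them.
\<close>

definition words :: "nat \<Rightarrow> nat set" where
  "words k = word ` lists {..<k}"

lemma words_mono: "k \<le> k' \<Longrightarrow> words k \<subseteq> words k'"
  unfolding words_def by (intro image_mono lists_mono) auto

lemma zero_in_words: "0 \<in> words k"
  unfolding words_def by (rule image_eqI[of _ _ "[]"]) auto

lemma wcat_in_words: "m \<in> words k \<Longrightarrow> n \<in> words k \<Longrightarrow> m \<star> n \<in> words k"
  unfolding words_def by (force simp: word_append[symmetric])

lemma letter_in_words: "i < k \<Longrightarrow> letter i \<in> words k"
  unfolding words_def by (rule image_eqI[of _ _ "[i]"]) auto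

lemma append_fresh_eq:
  assumes "xs @ k # ys = xs' @ k # ys'" "k \<notin> set xs" "k \<notin> set xs'"
  shows "xs = xs'" "ys = ys'"
  using assms by (auto simp: append_eq_append_conv2 Cons_eq_append_conv append_eq_Cons_conv)

text \<open>
A word is cut at the first occurrence of the fresh letter in a unique way.
\<close>

lemma fresh_letter_split:
  assumes "m \<in> words k" "m' \<in> words k" "n \<in> words k'" "n' \<in> words k'"
    and eq: "m \<star> letter k \<star> n = m' \<star> letter k \<star> n'"
  shows "m = m'" "n = n'"
proof -
  obtain xs xs' ys ys' where w: "m = word xs" "m' = word xs'" "n = word ys" "n' = word ys'"
    and s: "set xs \<subseteq> {..<k}" "set xs' \<subseteq> {..<k}"
    using assms(1-4) unfolding words_def by blast
  have "word (xs @ k # ys) = word (xs' @ k # ys')"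
    using eq by (simp add: word_append w)
  then show "m = m'" "n = n'"
    using s append_fresh_eq[of xs k ys xs' ys'] by (auto simp: w)
qed

lemma fresh_letter_neq:
  assumes "m \<in> words k" "m' \<in> words k" "n \<in> words k'"
  shows "m \<noteq> m' \<star> letter k \<star> n"
proof
  assume eq: "m = m' \<star> letter k \<star> n"
  obtain xs xs' ys where w: "m = word xs" "m' = word xs'" "n = word ys"
    and s: "set xs \<subseteq> {..<k}"
    using assms unfolding words_def by blast
  have "word xs = word (xs' @ k # ys)"
    using eq by (simp add: word_append w)
  then show False using s by auto
qed


section \<open>Polynomials over the field with two elements\<close>

lemma bit_add_self: "x + x = (0 :: bit)"
  by (cases x) simp_all

lemma poly_add_self [simp]: "p + p = (0 :: bit poly)"
  by (rule poly_eqI) (simp only: coeff_add bit_add_self coeff_0)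

lemma lead_coeff_bit: "p \<noteq> 0 \<Longrightarrow> lead_coeff p = (1 :: bit)"
  by (metis bit_not_zero_iff leading_coeff_0_iff)

text \<open>
Here the choice of the field matters: all leading coefficients are \<open>1\<close>, so that equal degrees
always lead to cancellation.
\<close>

lemma degree_add_less:
  fixes p q :: "bit poly"
  assumes "p \<noteq> 0" "q \<noteq> 0" "degree p = degree q" "p + q \<noteq> 0"
  shows "degree (p + q) < degree p"
proof -
  have "coeff (p + q) (degree p) = 0"
    using assms lead_coeff_bit[of p] lead_coeff_bit[of q] by (simp add: bit_add_self)
  moreover have "degree (p + q) \<le> degree p"
    using degree_add_le_max[of p q] assms by simp
  ultimately show ?thesis
    using assms(4) by (metis leading_coeff_0_iff le_neq_implies_less)
qed

section \<open>Additive operators and their leads\<close>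

typedef endo = "{f :: bit poly \<Rightarrow> bit poly. \<forall>p q. f (p + q) = f p + f q}"
  morphisms app Endo
  by (rule exI[of _ "\<lambda>p. p"]) simp

setup_lifting type_definition_endo

lemma app_add [simp]: "app f (p + q) = app f p + app f q"
  using app[of f] by simp

lemma app_0 [simp]: "app f 0 = 0"
  using app_add[of f 0 0] by simp

instantiation endo :: ring_1
begin

lift_definition zero_endo :: endo is "\<lambda>p. 0" by simp
lift_definition one_endo :: endo is "\<lambda>p. p" by simp
lift_definition plus_endo :: "endo \<Rightarrow> endo \<Rightarrow> endo" is "\<lambda>f g p. f p + g p"
  by (simp add: algebra_simps)
lift_definition uminus_endo :: "endo \<Rightarrow> endo" is "\<lambda>f p. - f p"
  by simp
lift_definition minus_endo :: "endo \<Rightarrow> endo \<Rightarrow> endo" is "\<lambda>f g p. f p - g p"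
  by (simp add: algebra_simps)
lift_definition times_endo :: "endo \<Rightarrow> endo \<Rightarrow> endo" is "\<lambda>f g p. f (g p)"
  by simp

instance
proof
  show "(0 :: endo) \<noteq> 1"
    by transfer (auto simp: fun_eq_iff intro: exI[of _ 1])
qed (transfer; auto simp: algebra_simps fun_eq_iff; fail)+

end

lemma app_simps [simp]:
  "app 0 p = 0" "app 1 p = p" "app (f + g) p = app f p + app g p" "app (f * g) p = app f (app g p)"
  by (simp_all add: zero_endo.rep_eq one_endo.rep_eq plus_endo.rep_eq times_endo.rep_eq)

lemma endo_eqI: "(\<And>p. app f p = app g p) \<Longrightarrow> f = g"
  by transfer auto

lemma endo_add_self [simp]: "f + f = (0 :: endo)"
  by (rule endo_eqI) simp

lemma endo_add_self_left [simp]: "f + (f + g) = (g :: endo)"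
  by (simp add: add.assoc[symmetric])

definition lead :: "endo \<Rightarrow> nat \<Rightarrow> bool" where
  "lead f m \<longleftrightarrow> (\<forall>p. p \<noteq> 0 \<longrightarrow> app f p \<noteq> 0 \<and> degree (app f p) = m \<star> degree p)"

lemma leadD: "lead f m \<Longrightarrow> p \<noteq> 0 \<Longrightarrow> app f p \<noteq> 0"
  "lead f m \<Longrightarrow> p \<noteq> 0 \<Longrightarrow> degree (app f p) = m \<star> degree p"
  by (simp_all add: lead_def)

lemma lead_degree: "lead f m \<Longrightarrow> degree (app f 1) = m"
  using leadD(2)[of f m 1] by simp

lemma lead_unique: "lead f m \<Longrightarrow> lead f n \<Longrightarrow> m = n"
  using lead_degree by blast

lemma lead_nonzero: "lead f m \<Longrightarrow> f \<noteq> 0"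
  using leadD(1)[of f m 1] by auto

lemma lead_one: "lead 1 0"
  by (simp add: lead_def)

lemma lead_times: "lead f m \<Longrightarrow> lead g n \<Longrightarrow> lead (f * g) (m \<star> n)"
  by (simp add: lead_def wcat_assoc)

lemma lead_add:
  assumes "lead f m" "lead g n" "n < m"
  shows "lead (f + g) m"
  unfolding lead_def
proof (intro allI impI)
  fix p :: "bit poly" assume p: "p \<noteq> 0"
  have "degree (app g p) < degree (app f p)"
    using p assms by (simp add: leadD)
  then have "degree (app (f + g) p) = degree (app f p)" "degree (app f p) \<noteq> 0"
    by (simp_all add: degree_add_eq_left)
  then show "app (f + g) p \<noteq> 0 \<and> degree (app (f + g) p) = m \<star> degree p"
    using p assms(1) by (metis degree_0 leadD(2))
qed

text \<open>
The sum of two operators with the same lead need not have a lead; the hypothesis on the sum becomes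
available inside the rings considered below.
\<close>

lemma lead_add_same:
  assumes "lead f m" "lead g m" "lead (f + g) n"
  shows "n < m"
  using degree_add_less[of "app f 1" "app g 1"] leadD(1)[OF assms(1), of 1]
    leadD(1)[OF assms(2), of 1] leadD(1)[OF assms(3), of 1]
    lead_degree[OF assms(1)] lead_degree[OF assms(2)] lead_degree[OF assms(3)] by simp

lemma degree_sum_monom_wcat:
  fixes p :: "bit poly" and m :: nat
  defines "s \<equiv> \<Sum>i\<le>degree p. monom (coeff p i) (m \<star> i)"
  assumes "p \<noteq> 0"
  shows "s \<noteq> 0" "degree s = m \<star> degree p"
proof -
  have c: "coeff s (m \<star> degree p) = 1"
    using lead_coeff_bit[OF \<open>p \<noteq> 0\<close>] by (simp add: s_def coeff_sum sum.delta)
  then show "s \<noteq> 0" by auto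
  have "degree s \<le> m \<star> degree p"
    unfolding s_def by (rule degree_sum_le) (auto intro: order.trans[OF degree_monom_le])
  then show "degree s = m \<star> degree p"
    using c le_degree[of s "m \<star> degree p"] by simp
qed

lemma exists_endo_with_lead: "\<exists>E. lead E m"
proof -
  define F :: "bit poly \<Rightarrow> bit poly" where
    "F = (\<lambda>p. \<Sum>i\<le>degree p. monom (coeff p i) (m \<star> i))"
  have F_upto: "F p = (\<Sum>i\<le>n. monom (coeff p i) (m \<star> i))" if "degree p \<le> n" for p n
    unfolding F_def using that
    by (intro sum.mono_neutral_left) (auto simp: coeff_eq_0)
  have "F (p + q) = F p + F q" for p q
  proof -
    have "degree p \<le> max (degree p) (degree q)" "degree q \<le> max (degree p) (degree q)"
      by simp_all
    then show ?thesis
      using degree_add_le_max[of p q]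
      by (simp only: F_upto[of _ "max (degree p) (degree q)"] coeff_add add_monom[symmetric]
          sum.distrib)
  qed
  then have "app (Endo F) = F"
    by (simp add: Endo_inverse)
  then have "lead (Endo F) m"
    using degree_sum_monom_wcat[of _ m] unfolding lead_def F_def by simp
  then show ?thesis ..
qed

text \<open>
As leads of values of \<open>a\<close> are known, the polynomials without exponents in \<open>m \<star> \<nat>\<close> form a complement
of the image of \<open>a\<close>. The left inverse is zero on this complement. The degree bound holds because the
two components of a polynomial cannot cancel in the highest degree.
\<close>

lemma exists_left_inverse:
  assumes a: "lead a m"
  shows "\<exists>q. q * a = 1 \<and> (\<forall>p. m \<star> degree (app q p) \<le> degree p \<or> app q p = 0)"
proof -
  define C :: "bit poly set" where "C = {t. \<forall>i. coeff t (m \<star> i) = 0}"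
  have C_add: "t + t' \<in> C" if "t \<in> C" "t' \<in> C" for t t'
    using that by (simp add: C_def)
  have degree_C: "degree t \<noteq> m \<star> i" if "t \<in> C" "t \<noteq> 0" for t i
    using that lead_coeff_bit[of t] by (auto simp: C_def)
  \<comment> \<open>In characteristic two, \<open>p + app a s \<in> C\<close> says that \<open>p\<close> is \<open>app a s\<close> plus an element of \<open>C\<close>.\<close>
  have trivial: "s = 0" if "app a s \<in> C" for s
    using degree_C[OF that] leadD[OF a, of s] by blast
  have ex: "\<exists>s. p + app a s \<in> C" for p
  proof (induction "if p = 0 then 0 else Suc (degree p)" arbitrary: p rule: less_induct)
    case less
    show ?case
    proof (cases "p = 0")
      case True
      then show ?thesis by (intro exI[of _ 0]) (simp add: C_def)
    next
      case False
      have smaller: "\<exists>s. p + r + app a s \<in> C" if "r \<noteq> 0" "degree r = degree p" for r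
        using less[of "p + r"] degree_add_less[of p r] that False
        by (cases "p + r = 0") auto
      show ?thesis
      proof (cases "\<exists>i. degree p = m \<star> i")
        case True
        then obtain i where i: "degree p = m \<star> i" ..
        obtain s where "p + app a (monom 1 i) + app a s \<in> C"
          using smaller[of "app a (monom 1 i)"] leadD[OF a, of "monom 1 i"] i
          by (auto simp: degree_monom_eq)
        then show ?thesis by (intro exI[of _ "monom 1 i + s"]) (simp add: add.assoc)
      next
        case no: False
        obtain s where s: "p + monom 1 (degree p) + app a s \<in> C"
          using smaller[of "monom 1 (degree p)"] by (auto simp: degree_monom_eq)
        moreover have "monom 1 (degree p) \<in> C"
          using no by (auto simp: C_def)
        ultimately have "p + monom 1 (degree p) + app a s + monom 1 (degree p) \<in> C"
          by (rule C_add)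
        then have "p + app a s + (monom 1 (degree p) + monom 1 (degree p)) \<in> C"
          by (simp only: ac_simps)
        then show ?thesis by auto
      qed
    qed
  qed
  define Q where "Q p = (SOME s. p + app a s \<in> C)" for p
  have Q: "p + app a (Q p) \<in> C" for p
    unfolding Q_def using ex by (rule someI_ex)
  have Q_eq: "Q p = s" if "p + app a s \<in> C" for p s
  proof -
    have "p + app a s + (p + app a (Q p)) \<in> C"
      using that Q by (rule C_add)
    also have "p + app a s + (p + app a (Q p)) = (p + p) + app a (s + Q p)"
      by (simp only: ac_simps app_add)
    finally have "s + Q p = 0" using trivial by simp
    then have "s + (s + Q p) = s" by simp
    then show ?thesis by (simp add: add.assoc[symmetric])
  qed
  have "Q (p + p') = Q p + Q p'" for p p'
  proof (rule Q_eq)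
    have "p + app a (Q p) + (p' + app a (Q p')) \<in> C"
      by (intro C_add Q)
    then show "p + p' + app a (Q p + Q p') \<in> C" by (simp add: ac_simps)
  qed
  then have app_Q: "app (Endo Q) = Q"
    by (simp add: Endo_inverse)
  have "Q (app a p) = p" for p
    by (rule Q_eq) (simp add: C_def)
  then have "Endo Q * a = 1"
    by (intro endo_eqI) (simp add: app_Q)
  moreover have "m \<star> degree (Q p) \<le> degree p" if "Q p \<noteq> 0" for p
  proof (rule ccontr)
    assume "\<not> ?thesis"
    then have less: "degree p < degree (app a (Q p))"
      using leadD[OF a that] by simp
    then have "degree (p + app a (Q p)) = m \<star> degree (Q p)"
      using leadD[OF a that] by (simp add: degree_add_eq_right)
    moreover have "p + app a (Q p) \<noteq> 0"
      using less calculation leadD[OF a that] by auto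
    ultimately show False
      using degree_C[OF Q[of p]] by blast
  qed
  ultimately show ?thesis
    using app_Q by (intro exI[of _ "Endo Q"]) auto
qed


text \<open>
For operators with a lead this is the lead. It is a total function, which makes it possible to speak
of sets of operators with distinct leads.
\<close>

definition ld :: "endo \<Rightarrow> nat" where
  "ld f = degree (app f 1)"

lemma ld_eq: "lead f m \<Longrightarrow> ld f = m"
  unfolding ld_def by (rule lead_degree)

section \<open>Sums of operators with distinct leads\<close>

text \<open>
The additive span; over the field with two elements no coefficients are needed.
\<close>

inductive_set asum :: "endo set \<Rightarrow> endo set" for N where
  zero: "0 \<in> asum N"
| add: "f \<in> N \<Longrightarrow> g \<in> asum N \<Longrightarrow> f + g \<in> asum N"

lemma asum_base: "f \<in> N \<Longrightarrow> f \<in> asum N"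
  using asum.add[OF _ asum.zero] by force

lemma asum_plus: "f \<in> asum N \<Longrightarrow> g \<in> asum N \<Longrightarrow> f + g \<in> asum N"
  by (induction rule: asum.induct) (auto simp: add.assoc intro: asum.add)

lemma asum_least:
  assumes "f \<in> asum N" "N \<subseteq> Z" "0 \<in> Z" "\<And>y z. y \<in> Z \<Longrightarrow> z \<in> Z \<Longrightarrow> y + z \<in> Z"
  shows "f \<in> Z"
  using assms(1) by induction (use assms in auto)

lemma asum_left:
  assumes "t \<in> asum N" "\<And>f. f \<in> N \<Longrightarrow> h * f \<in> asum N'"
  shows "h * t \<in> asum N'"
  using assms(1) by induction (auto simp: distrib_left intro: asum.zero asum_plus assms(2))

lemma asum_right:
  assumes "t \<in> asum N" "\<And>f. f \<in> N \<Longrightarrow> f * h \<in> asum N'"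
  shows "t * h \<in> asum N'"
  using assms(1) by induction (auto simp: distrib_right intro: asum.zero asum_plus assms(2))

lemma asum_eq_sum: "f \<in> asum N \<Longrightarrow> \<exists>F. finite F \<and> F \<subseteq> N \<and> f = \<Sum>F"
proof (induction rule: asum.induct)
  case zero
  show ?case by (intro exI[of _ "{}"]) simp
next
  case (add f g)
  then obtain F where F: "finite F" "F \<subseteq> N" "g = \<Sum>F" by blast
  show ?case
  proof (cases "f \<in> F")
    case True
    then have "f + g = \<Sum>(F - {f})"
      using F by (simp add: sum.remove[of F f])
    then show ?thesis using F by (intro exI[of _ "F - {f}"]) auto
  next
    case False
    then show ?thesis using F add by (intro exI[of _ "insert f F"]) auto
  qed
qed

lemma lead_add_sum:
  assumes "finite F" "lead g m" "\<And>f. f \<in> F \<Longrightarrow> lead f (ld f) \<and> ld f < m"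
  shows "lead (g + \<Sum>F) m"
  using assms
proof (induction F)
  case (insert f F)
  then have "lead (g + \<Sum>F + f) m"
    by (intro lead_add[of _ m f "ld f"]) auto
  then show ?case using insert.hyps by (simp add: ac_simps)
qed simp

text \<open>
After repeated summands have been cancelled, the leads of the summands are distinct, and the largest
one dominates.
\<close>

lemma lead_asum:
  assumes leads: "\<And>f. f \<in> N \<Longrightarrow> lead f (ld f)" and inj: "inj_on ld N"
    and f: "f \<in> asum N" "f \<noteq> 0"
  shows "\<exists>g\<in>N. lead f (ld g)"
proof -
  obtain F where F: "finite F" "F \<subseteq> N" "f = \<Sum>F"
    using asum_eq_sum[OF f(1)] by blast
  have "F \<noteq> {}" using F f(2) by auto
  then have "Max (ld ` F) \<in> ld ` F" using F by simp
  then obtain g where g: "g \<in> F" "ld g = Max (ld ` F)" by force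
  have "ld h < ld g" if "h \<in> F - {g}" for h
  proof -
    have "ld h \<le> ld g" using that F g by simp
    moreover have "ld h \<noteq> ld g" using that F g inj_onD[OF inj, of h g] by auto
    ultimately show ?thesis by simp
  qed
  moreover have leads_F: "lead h (ld h)" if "h \<in> F" for h
    using that F leads by blast
  ultimately have "lead (g + \<Sum>(F - {g})) (ld g)"
    using F(1) leads_F[OF g(1)] by (intro lead_add_sum) blast+
  moreover have "f = g + \<Sum>(F - {g})"
    using F g by (simp add: sum.remove[of F g])
  ultimately show ?thesis using F(2) g(1) by auto
qed

section \<open>Rings of operators with leads\<close>

text \<open>
Closure under negation is automatic in characteristic two.
\<close>

definition lead_ring :: "endo set \<Rightarrow> nat set \<Rightarrow> bool" where
  "lead_ring R W \<longleftrightarrow> 1 \<in> R \<and> (\<forall>f\<in>R. \<forall>g\<in>R. f + g \<in> R \<and> f * g \<in> R)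
     \<and> (\<forall>f\<in>R. f \<noteq> 0 \<longrightarrow> (\<exists>m\<in>W. lead f m))"

lemma lead_ringD:
  assumes "lead_ring R W"
  shows "1 \<in> R" "0 \<in> R" "f \<in> R \<Longrightarrow> g \<in> R \<Longrightarrow> f + g \<in> R" "f \<in> R \<Longrightarrow> g \<in> R \<Longrightarrow> f * g \<in> R"
    "f \<in> R \<Longrightarrow> f \<noteq> 0 \<Longrightarrow> lead f (ld f)" "f \<in> R \<Longrightarrow> f \<noteq> 0 \<Longrightarrow> ld f \<in> W"
proof -
  show one: "1 \<in> R" and add: "f \<in> R \<Longrightarrow> g \<in> R \<Longrightarrow> f + g \<in> R" for f g
    using assms by (simp_all add: lead_ring_def)
  show "0 \<in> R" using add[OF one one] by simp
qed (use assms ld_eq in \<open>auto simp: lead_ring_def\<close>)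

text \<open>
The difference of two elements either is zero or has a lead and is then injective.
\<close>

lemma lead_ring_eqI:
  assumes "lead_ring R W" "f \<in> R" "g \<in> R" "app f 1 = app g 1"
  shows "f = g"
proof -
  have "f + g = 0"
  proof (rule ccontr)
    assume "f + g \<noteq> 0"
    then have "app (f + g) 1 \<noteq> 0"
      using lead_ringD(3,5)[OF assms(1)] assms(2,3) leadD(1)[of "f + g" _ 1] by auto
    then show False using assms(4) by simp
  qed
  then show ?thesis by (metis add.right_neutral endo_add_self_left)
qed

text \<open>
Reduction of leading terms: subtracting a suitable element of \<open>Z\<close> lowers the lead, and leads are
well-ordered. This is used to see that elements with all possible leads span, and that a complement
of the left ideal \<open>R a\<close> is spanned by elements whose leads do not occur in \<open>R a\<close>.
\<close>

lemma lead_ring_descent: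
  assumes R: "lead_ring R W" and "Z \<subseteq> R" "0 \<in> Z" "\<And>y z. y \<in> Z \<Longrightarrow> z \<in> Z \<Longrightarrow> y + z \<in> Z"
    and hit: "\<And>f. f \<in> R \<Longrightarrow> f \<noteq> 0 \<Longrightarrow> \<exists>z\<in>Z. z \<noteq> 0 \<and> ld z = ld f"
  shows "R \<subseteq> Z"
proof
  show "f \<in> R \<Longrightarrow> f \<in> Z" for f
  proof (induction "if f = 0 then 0 else Suc (ld f)" arbitrary: f rule: less_induct)
    case less
    show ?case
    proof (cases "f = 0")
      case False
      then obtain z where z: "z \<in> Z" "z \<noteq> 0" "ld z = ld f"
        using hit less.prems by blast
      then have zR: "z \<in> R" using assms(2) by blast
      have fz: "f + z \<in> R" using less.prems zR lead_ringD(3)[OF R] by blast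
      have "f + z \<in> Z"
      proof (cases "f + z = 0")
        case nz: False
        have "ld (f + z) < ld f"
          using lead_add_same[of f "ld f" z "ld (f + z)"] lead_ringD(5)[OF R] less.prems zR fz z nz
            False by metis
        then show ?thesis using less.hyps[of "f + z"] fz False by simp
      qed (use assms in simp)
      then have "f + z + z \<in> Z" using z assms(4) by blast
      then show ?thesis by (simp add: add.assoc)
    qed (use assms in simp)
  qed
qed

section \<open>Adjoining a solution\<close>

text \<open>
The normal words for the extension by \<open>b\<close> and \<open>c\<close>. Here \<open>B\<close> is a basis of the old ring and
\<open>D \<subseteq> B\<close> one of a complement of the left ideal generated by \<open>a\<close>.
\<close>

inductive_set nwords :: "endo set \<Rightarrow> endo set \<Rightarrow> endo \<Rightarrow> endo \<Rightarrow> endo set" for B D b c where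
  base: "\<beta> \<in> B \<Longrightarrow> \<beta> \<in> nwords B D b c"
| c: "\<beta> \<in> B \<Longrightarrow> f \<in> nwords B D b c \<Longrightarrow> \<beta> * (c * f) \<in> nwords B D b c"
| b: "\<beta> \<in> D \<Longrightarrow> f \<in> nwords B D b c \<Longrightarrow> \<beta> * (b * f) \<in> nwords B D b c"

text \<open>
The only products that are not visibly sums of normal words are those of the form \<open>t b f\<close> with
\<open>t \<in> R\<close>. Writing \<open>t = s a + d\<close> with \<open>d\<close> in the span of \<open>D\<close> and using \<open>a b = x + c a\<close>, one gets
\<open>t b f = d b f + (s x) f + s c (a f)\<close>, where \<open>b\<close> has disappeared in front of \<open>f\<close>; so induction on
the length of the normal word applies.
\<close>

lemma asum_nwords_closed:
  assumes R: "lead_ring R W" and "B \<subseteq> R" "D \<subseteq> R" and x: "x \<in> R" and a: "a \<in> R"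
    and span: "R \<subseteq> asum B" and cospan: "\<And>f. f \<in> R \<Longrightarrow> \<exists>s\<in>R. f + s * a \<in> asum D"
    and rel: "x = a * b + c * a"
  defines "S \<equiv> asum (nwords B D b c)"
  shows "R \<subseteq> S" "b \<in> S" "c \<in> S" "f \<in> S \<Longrightarrow> g \<in> S \<Longrightarrow> f * g \<in> S"
proof -
  let ?N = "nwords B D b c"
  show RS: "R \<subseteq> S"
    using span asum_least[of _ B S] unfolding S_def
    by (auto intro: asum_base nwords.base asum.zero asum_plus)
  have c1: "t * (c * f) \<in> S" if "t \<in> R" "f \<in> ?N" for t f
    using asum_right[of t B "c * f" ?N] span that unfolding S_def
    by (auto intro: asum_base nwords.c)
  have c2: "t * (c * g) \<in> S" if "t \<in> R" "g \<in> S" for t g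
    using asum_left[of g ?N "t * c" ?N] c1 that unfolding S_def by (simp add: mult.assoc)
  have b1: "t * (b * f) \<in> S" if t: "t \<in> R" and f: "f \<in> ?N" and IH: "\<And>t. t \<in> R \<Longrightarrow> t * f \<in> S" for t f
  proof -
    obtain s where s: "s \<in> R" "t + s * a \<in> asum D" using cospan[OF t] by blast
    have ab: "a * b = x + c * a" by (simp add: rel add.assoc)
    have "t * (b * f) = (t + s * a) * (b * f) + s * (a * b) * f"
      by (simp add: algebra_simps)
    also have "s * (a * b) * f = (s * x) * f + s * (c * (a * f))"
      unfolding ab by (simp add: algebra_simps)
    finally have eq: "t * (b * f) = (t + s * a) * (b * f) + ((s * x) * f + s * (c * (a * f)))" .
    have "(t + s * a) * (b * f) \<in> S"
      using asum_right[OF s(2), of "b * f" ?N] f unfolding S_def by (auto intro: asum_base nwords.b)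
    moreover have "(s * x) * f \<in> S" using IH lead_ringD(4)[OF R] s x by blast
    moreover have "s * (c * (a * f)) \<in> S" using c2 IH s a by blast
    ultimately show ?thesis unfolding eq S_def by (intro asum_plus)
  qed
  have R1: "t * f \<in> S" if "f \<in> ?N" "t \<in> R" for t f
    using that
  proof (induction arbitrary: t rule: nwords.induct)
    case (base \<beta>)
    then show ?case using RS lead_ringD(4)[OF R] assms(2) by blast
  next
    case (c \<beta> f)
    then have "(t * \<beta>) * (c * f) \<in> S" using c1 lead_ringD(4)[OF R] assms(2) by blast
    then show ?case by (simp add: mult.assoc)
  next
    case (b \<beta> f)
    then have "(t * \<beta>) * (b * f) \<in> S" using b1 lead_ringD(4)[OF R] assms(3) by blast
    then show ?case by (simp add: mult.assoc)
  qed
  have R2: "t * g \<in> S" if "g \<in> S" "t \<in> R" for t g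
    using asum_left[of g ?N t ?N] R1 that unfolding S_def by blast
  have b2: "t * (b * g) \<in> S" if "t \<in> R" "g \<in> S" for t g
    using asum_left[of g ?N "t * b" ?N] b1 R1 that unfolding S_def by (simp add: mult.assoc)
  note one = lead_ringD(1)[OF R]
  show "b \<in> S" "c \<in> S"
    using b2[of 1 1] c2[of 1 1] one RS by auto
  have N: "f * g \<in> S" if "f \<in> ?N" "g \<in> S" for f g
    using that
  proof (induction rule: nwords.induct)
    case (base \<beta>)
    then show ?case using R2 assms(2) by blast
  next
    case (c \<beta> f)
    then have "\<beta> * (c * (f * g)) \<in> S" using c2 assms(2) by blast
    then show ?case by (simp add: mult.assoc)
  next
    case (b \<beta> f)
    then have "\<beta> * (b * (f * g)) \<in> S" using b2 assms(3) by blast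
    then show ?case by (simp add: mult.assoc)
  qed
  show "f * g \<in> S" if "f \<in> S" "g \<in> S"
    using asum_right[of f ?N g ?N] N that unfolding S_def by blast
qed

text \<open>
With \<open>e = letter k\<close>, the normal words \<open>\<beta> c f\<close> and \<open>\<beta> b f\<close> have the leads
\<open>(ld \<beta> \<star> m) \<star> e \<star> ld f\<close> and \<open>ld \<beta> \<star> e \<star> (m \<star> ld f)\<close>. The part in front of the first \<open>e\<close> tells
the two apart, as the leads of \<open>D\<close> are not of the form \<open>ld \<gamma> \<star> m\<close>. Then \<open>\<beta>\<close> and, by induction,
\<open>f\<close> can be recovered.
\<close>

lemma nwords_leads:
  assumes B: "\<And>\<beta>. \<beta> \<in> B \<Longrightarrow> lead \<beta> (ld \<beta>) \<and> ld \<beta> \<in> words k" and inj: "inj_on ld B"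
    and D: "D \<subseteq> B" "\<And>\<beta> \<gamma>. \<beta> \<in> D \<Longrightarrow> \<gamma> \<in> B \<Longrightarrow> ld \<beta> \<noteq> ld \<gamma> \<star> m" and m: "m \<in> words k"
    and b: "lead b (letter k \<star> m)" and c: "lead c (m \<star> letter k)"
  defines "N \<equiv> nwords B D b c"
  shows "f \<in> N \<Longrightarrow> lead f (ld f)" "f \<in> N \<Longrightarrow> ld f \<in> words (Suc k)" "inj_on ld N"
proof -
  have ld_c: "lead (\<beta> * (c * f)) ((ld \<beta> \<star> m) \<star> letter k \<star> ld f)"
    if "\<beta> \<in> B" "lead f (ld f)" for \<beta> f
    using lead_times[OF _ lead_times[OF c that(2)], of \<beta>] B[OF that(1)] by (simp add: wcat_assoc)
  have ld_b: "lead (\<beta> * (b * f)) (ld \<beta> \<star> letter k \<star> m \<star> ld f)"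
    if "\<beta> \<in> D" "lead f (ld f)" for \<beta> f
    using lead_times[OF _ lead_times[OF b that(2)], of \<beta>] B[of \<beta>] D(1) that(1)
    by (auto simp add: wcat_assoc)
  have mono: "words k \<subseteq> words (Suc k)" by (rule words_mono) simp
  have both: "lead f (ld f) \<and> ld f \<in> words (Suc k)" if "f \<in> N" for f
    using that unfolding N_def
  proof (induction rule: nwords.induct)
    case (base \<beta>)
    then show ?case using B mono by blast
  next
    case (c \<beta> f)
    then have l: "lead (\<beta> * (c * f)) ((ld \<beta> \<star> m) \<star> letter k \<star> ld f)" using ld_c by blast
    moreover have "(ld \<beta> \<star> m) \<star> letter k \<star> ld f \<in> words (Suc k)"
      using c B mono m by (intro wcat_in_words letter_in_words) auto
    ultimately show ?case using ld_eq by metis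
  next
    case (b \<beta> f)
    then have l: "lead (\<beta> * (b * f)) (ld \<beta> \<star> letter k \<star> m \<star> ld f)" using ld_b by blast
    moreover have "ld \<beta> \<star> letter k \<star> m \<star> ld f \<in> words (Suc k)"
      using b B D(1) mono m by (intro wcat_in_words letter_in_words) auto
    ultimately show ?case using ld_eq by metis
  qed
  then show leads: "f \<in> N \<Longrightarrow> lead f (ld f)" and words: "f \<in> N \<Longrightarrow> ld f \<in> words (Suc k)" for f
    by blast+
  have ld_c': "ld (\<beta> * (c * f)) = (ld \<beta> \<star> m) \<star> letter k \<star> ld f" if "\<beta> \<in> B" "f \<in> N" for \<beta> f
    using ld_c[OF that(1) leads[OF that(2)]] by (rule ld_eq)
  have ld_b': "ld (\<beta> * (b * f)) = ld \<beta> \<star> letter k \<star> m \<star> ld f" if "\<beta> \<in> D" "f \<in> N" for \<beta> f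
    using ld_b[OF that(1) leads[OF that(2)]] by (rule ld_eq)
  have Bm: "ld \<beta> \<star> m \<in> words k" if "\<beta> \<in> B" for \<beta>
    using B[OF that] m by (simp add: wcat_in_words)
  have mN: "m \<star> ld f \<in> words (Suc k)" if "f \<in> N" for f
    using words[OF that] m mono by (auto intro: wcat_in_words)
  have "f = g" if "f \<in> N" "g \<in> N" "ld f = ld g" for f g
    using that unfolding N_def
  proof (induction arbitrary: g rule: nwords.induct)
    case (base \<beta>)
    note \<beta> = B[OF base.hyps]
    from base.prems(1) show ?case
    proof cases
      case base': base
      then show ?thesis using base inj by (auto dest: inj_onD)
    next
      case c': (c \<gamma> h)
      then have h: "h \<in> N" by (simp add: N_def)
      have "ld \<beta> = (ld \<gamma> \<star> m) \<star> letter k \<star> ld h"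
        using base.prems(2) ld_c'[OF c'(2) h] c'(1) by simp
      then show ?thesis
        using fresh_letter_neq[OF conjunct2[OF \<beta>] Bm[OF c'(2)] words[OF h]] by simp
    next
      case b': (b \<gamma> h)
      then have h: "h \<in> N" and \<gamma>: "\<gamma> \<in> B" using D(1) by (auto simp: N_def)
      have "ld \<beta> = ld \<gamma> \<star> letter k \<star> (m \<star> ld h)"
        using base.prems(2) ld_b'[OF b'(2) h] b'(1) by simp
      then show ?thesis
        using fresh_letter_neq[OF conjunct2[OF \<beta>] conjunct2[OF B[OF \<gamma>]] mN[OF h]] by simp
    qed
  next
    case (c \<beta> f)
    have f: "f \<in> N" using c.hyps by (simp add: N_def)
    note \<beta> = c.hyps(1)
    have ldg: "ld g = (ld \<beta> \<star> m) \<star> letter k \<star> ld f"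
      using ld_c'[OF \<beta> f] c.prems(2) by simp
    from c.prems(1) show ?case
    proof cases
      case base
      then show ?thesis
        using fresh_letter_neq[OF conjunct2[OF B] Bm[OF \<beta>] words[OF f], of g] ldg by simp
    next
      case c': (c \<gamma> h)
      then have h: "h \<in> N" by (simp add: N_def)
      have "(ld \<beta> \<star> m) \<star> letter k \<star> ld f = (ld \<gamma> \<star> m) \<star> letter k \<star> ld h"
        using ldg ld_c'[OF c'(2) h] c'(1) by simp
      from fresh_letter_split[OF Bm[OF \<beta>] Bm[OF c'(2)] words[OF f] words[OF h] this]
      have "ld \<beta> = ld \<gamma>" "ld f = ld h" by simp_all
      then have "\<beta> = \<gamma>" "f = h"
        using inj_onD[OF inj _ \<beta> c'(2)] c.IH[OF c'(3)] by simp_all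
      then show ?thesis using c'(1) by simp
    next
      case b': (b \<gamma> h)
      then have h: "h \<in> N" and \<gamma>: "\<gamma> \<in> B" using D(1) by (auto simp: N_def)
      have "(ld \<beta> \<star> m) \<star> letter k \<star> ld f = ld \<gamma> \<star> letter k \<star> (m \<star> ld h)"
        using ldg ld_b'[OF b'(2) h] b'(1) by simp
      from fresh_letter_split(1)[OF Bm[OF \<beta>] conjunct2[OF B[OF \<gamma>]] words[OF f] mN[OF h] this]
      show ?thesis using D(2)[OF b'(2) \<beta>] by simp
    qed
  next
    case (b \<beta> f)
    have f: "f \<in> N" and \<beta>: "\<beta> \<in> B" using b.hyps D(1) by (auto simp: N_def)
    have ldg: "ld g = ld \<beta> \<star> letter k \<star> (m \<star> ld f)"
      using ld_b'[OF b.hyps(1) f] b.prems(2) by simp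
    from b.prems(1) show ?case
    proof cases
      case base
      then show ?thesis
        using fresh_letter_neq[OF conjunct2[OF B] conjunct2[OF B[OF \<beta>]] mN[OF f], of g] ldg by simp
    next
      case c': (c \<gamma> h)
      then have h: "h \<in> N" by (simp add: N_def)
      have "(ld \<gamma> \<star> m) \<star> letter k \<star> ld h = ld \<beta> \<star> letter k \<star> (m \<star> ld f)"
        using ldg ld_c'[OF c'(2) h] c'(1) by simp
      from fresh_letter_split(1)[OF Bm[OF c'(2)] conjunct2[OF B[OF \<beta>]] words[OF h] mN[OF f] this]
      show ?thesis using D(2)[OF b.hyps(1) c'(2)] by simp
    next
      case b': (b \<gamma> h)
      then have h: "h \<in> N" and \<gamma>: "\<gamma> \<in> B" using D(1) by (auto simp: N_def)
      have "ld \<beta> \<star> letter k \<star> (m \<star> ld f) = ld \<gamma> \<star> letter k \<star> (m \<star> ld h)"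
        using ldg ld_b'[OF b'(2) h] b'(1) by simp
      from fresh_letter_split[OF conjunct2[OF B[OF \<beta>]] conjunct2[OF B[OF \<gamma>]] mN[OF f] mN[OF h] this]
      have "ld \<beta> = ld \<gamma>" "ld f = ld h" by simp_all
      then have "\<beta> = \<gamma>" "f = h"
        using inj_onD[OF inj _ \<beta> \<gamma>] b.IH[OF b'(3)] by simp_all
      then show ?thesis using b'(1) by simp
    qed
  qed
  then show "inj_on ld N" by (auto intro: inj_onI)
qed

lemma lead_ring_words_mono: "lead_ring R (words k) \<Longrightarrow> k \<le> k' \<Longrightarrow> lead_ring R (words k')"
  using words_mono[of k k'] unfolding lead_ring_def by blast

text \<open>
The leads of \<open>b\<close> and \<open>c\<close> are part of the conclusion because elements with such leads will
contradict the Ore conditions.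
\<close>

lemma adjoin_solution:
  assumes R: "lead_ring R (words k)" and x: "x \<in> R" and a: "a \<in> R" "a \<noteq> 0"
  shows "\<exists>R' j b c. R \<subseteq> R' \<and> lead_ring R' (words (Suc j)) \<and> k \<le> j \<and> b \<in> R' \<and> c \<in> R'
    \<and> x = a * b + c * a \<and> lead b (letter j \<star> ld a) \<and> lead c (ld a \<star> letter j)"
proof -
  \<comment> \<open>The letter \<open>j\<close> has to be fresh for \<open>R\<close> and larger than the lead of \<open>x\<close>.\<close>
  define j where "j = max k (Suc (ld x))"
  define m where "m = ld a"
  have Rj: "lead_ring R (words j)"
    using lead_ring_words_mono[OF R] by (simp add: j_def)
  note RD = lead_ringD[OF Rj]
  have a_lead: "lead a m" using RD(5) a by (simp add: m_def)
  have x_less: "ld x < letter j"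
    using le_letter[of j] by (simp add: j_def)
  obtain E where E: "lead E (letter j)" using exists_endo_with_lead by blast
  obtain q where q: "q * a = 1"
    and q_deg: "\<And>p. m \<star> degree (app q p) \<le> degree p \<or> app q p = 0"
    using exists_left_inverse[OF a_lead] by blast
  define b where "b = E * a"
  define c where "c = a * E + x * q"
  have "a * b + c * a = a * E * a + (a * E * a + x * (q * a))"
    by (simp add: b_def c_def algebra_simps)
  then have rel: "x = a * b + c * a" using q by simp
  have b_lead: "lead b (letter j \<star> m)"
    unfolding b_def using E a_lead by (rule lead_times)
  \<comment> \<open>\<open>q\<close> does not raise degrees and \<open>ld x < letter j\<close>, so \<open>a * E\<close> dominates \<open>x * q\<close>.\<close>
  have c_lead: "lead c (m \<star> letter j)"
    unfolding lead_def
  proof (intro allI impI)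
    fix p :: "bit poly" assume p: "p \<noteq> 0"
    have aE: "app (a * E) p \<noteq> 0" "degree (app (a * E) p) = (m \<star> letter j) \<star> degree p"
      using lead_times[OF a_lead E] leadD p by blast+
    show "app c p \<noteq> 0 \<and> degree (app c p) = (m \<star> letter j) \<star> degree p"
    proof (cases "app (x * q) p = 0")
      case True
      then have "app c p = app (a * E) p" by (simp add: c_def)
      then show ?thesis using aE by simp
    next
      case False
      then have "app q p \<noteq> 0" "x \<noteq> 0" by auto
      then have "degree (app (x * q) p) = ld x \<star> degree (app q p)"
        using RD(5) x leadD(2) by simp
      also have "\<dots> < letter j \<star> degree (app q p)"
        using x_less by simp
      also have "\<dots> \<le> letter j \<star> degree p"
      proof -
        have "0 \<star> degree (app q p) \<le> m \<star> degree (app q p)"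
          unfolding wcat_le_iff by simp
        then have "degree (app q p) \<le> degree p"
          using q_deg[of p] \<open>app q p \<noteq> 0\<close> by simp
        then show ?thesis by simp
      qed
      also have "\<dots> \<le> (m \<star> letter j) \<star> degree p"
        using wcat_le_iff(1)[of 0 "letter j" m] by (simp add: wcat_def)
      finally have less: "degree (app (x * q) p) < degree (app (a * E) p)"
        using aE by simp
      have c_eq: "app c p = app (a * E) p + app (x * q) p"
        by (simp add: c_def)
      have "degree (app c p) = degree (app (a * E) p)"
        unfolding c_eq using less by (rule degree_add_eq_left)
      then show ?thesis using aE less by auto
    qed
  qed
  \<comment> \<open>\<open>B\<close> contains exactly one element of each lead that occurs in \<open>R\<close>.\<close>
  have "ld ` (R - {0}) \<subseteq> ld ` (R - {0})" ..
  then obtain B where B: "B \<subseteq> R - {0}" "inj_on ld B" "ld ` (R - {0}) = ld ` B"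
    unfolding subset_image_inj by blast
  define D where "D = {\<beta> \<in> B. \<forall>\<gamma>\<in>B. ld \<beta> \<noteq> ld \<gamma> \<star> m}"
  have hit: "\<exists>\<beta>\<in>B. \<beta> \<noteq> 0 \<and> ld \<beta> = ld f" if "f \<in> R" "f \<noteq> 0" for f
  proof -
    have "ld f \<in> ld ` B" using that B(3) by blast
    then show ?thesis using B(1) by auto
  qed
  have span: "R \<subseteq> asum B"
  proof (rule lead_ring_descent[OF Rj _ asum.zero asum_plus])
    have "B \<subseteq> R" using B(1) by blast
    then show "asum B \<subseteq> R" using asum_least[OF _ _ RD(2,3), of _ B] by blast
    show "\<exists>z\<in>asum B. z \<noteq> 0 \<and> ld z = ld f" if "f \<in> R" "f \<noteq> 0" for f
      using hit[OF that] asum_base by blast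
  qed
  have cospan: "\<exists>s\<in>R. f + s * a \<in> asum D" if "f \<in> R" for f
  proof -
    define Z where "Z = {f \<in> R. \<exists>s\<in>R. f + s * a \<in> asum D}"
    have "R \<subseteq> Z"
    proof (rule lead_ring_descent[OF Rj])
      show "0 \<in> Z" unfolding Z_def using RD(2) asum.zero by force
      fix y z assume "y \<in> Z" "z \<in> Z"
      then obtain s t where st: "y \<in> R" "z \<in> R" "s \<in> R" "t \<in> R"
        "y + s * a \<in> asum D" "z + t * a \<in> asum D"
        unfolding Z_def by auto
      then have "y + z + (s + t) * a \<in> asum D"
        using asum_plus[OF st(5,6)] by (simp add: algebra_simps)
      then show "y + z \<in> Z"
        unfolding Z_def using RD(3)[OF st(1,2)] RD(3)[OF st(3,4)] by blast
    next
      fix f assume "f \<in> R" "f \<noteq> 0"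
      then obtain \<beta> where \<beta>: "\<beta> \<in> B" "\<beta> \<noteq> 0" "ld \<beta> = ld f" using hit by blast
      show "\<exists>z\<in>Z. z \<noteq> 0 \<and> ld z = ld f"
      proof (cases "\<beta> \<in> D")
        case True
        then have "\<beta> + 0 * a \<in> asum D" by (simp add: asum_base)
        then have "\<beta> \<in> Z"
          unfolding Z_def using \<beta>(1) B(1) RD(2) by blast
        then show ?thesis using \<beta> by blast
      next
        case False
        then obtain \<gamma> where \<gamma>: "\<gamma> \<in> B" "ld \<beta> = ld \<gamma> \<star> m" using \<beta> unfolding D_def by blast
        then have \<gamma>R: "\<gamma> \<in> R" "\<gamma> \<noteq> 0" using B by auto
        then have l: "lead (\<gamma> * a) (ld \<gamma> \<star> m)"
          using lead_times[OF RD(5) a_lead] by blast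
        have "\<gamma> * a + \<gamma> * a \<in> asum D" by (simp add: asum.zero)
        then have "\<gamma> * a \<in> Z"
          unfolding Z_def using \<gamma>R(1) RD(4)[OF \<gamma>R(1) a(1)] by blast
        moreover have "ld (\<gamma> * a) = ld f" using ld_eq[OF l] \<gamma>(2) \<beta>(3) by simp
        ultimately show ?thesis using lead_nonzero[OF l] by blast
      qed
    qed (auto simp: Z_def)
    then show ?thesis using that unfolding Z_def by blast
  qed
  define S where "S = asum (nwords B D b c)"
  have BR: "B \<subseteq> R" and DB: "D \<subseteq> B" using B by (auto simp: D_def)
  note closed = asum_nwords_closed[OF Rj BR subset_trans[OF DB BR] x a(1) span cospan rel, folded S_def]
  have m: "m \<in> words j" using RD(6) a by (simp add: m_def)
  have Bl: "lead \<beta> (ld \<beta>) \<and> ld \<beta> \<in> words j" if "\<beta> \<in> B" for \<beta>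
    using that B RD(5,6) by blast
  have Dl: "ld \<beta> \<noteq> ld \<gamma> \<star> m" if "\<beta> \<in> D" "\<gamma> \<in> B" for \<beta> \<gamma>
    using that by (auto simp: D_def)
  note leads = nwords_leads[OF Bl B(2) DB Dl m b_lead c_lead]
  have "\<exists>n\<in>words (Suc j). lead f n" if "f \<in> S" "f \<noteq> 0" for f
    using lead_asum[OF leads(1,3), of f] leads(2) that unfolding S_def by auto
  moreover have "1 \<in> S" using closed(1) RD(1) by (rule subsetD)
  moreover have "f + g \<in> S" if "f \<in> S" "g \<in> S" for f g
    using that unfolding S_def by (rule asum_plus)
  ultimately have "lead_ring S (words (Suc j))"
    unfolding lead_ring_def using closed(4) by simp
  moreover have "k \<le> j" by (simp add: j_def)
  ultimately show ?thesis
    using closed(1-3) rel b_lead c_lead unfolding m_def by (intro exI conjI)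
qed

section \<open>Exhausting all equations\<close>

definition solves :: "endo set \<Rightarrow> endo \<Rightarrow> endo \<Rightarrow> bool" where
  "solves R x a \<longleftrightarrow> (\<exists>b\<in>R. \<exists>c\<in>R. x = a * b + c * a)"

definition poly_code :: "bit poly \<Rightarrow> nat" where
  "poly_code p = to_nat (map (\<lambda>t. t = 1) (coeffs p))"

lemma inj_poly_code: "inj poly_code"
proof (rule injI)
  fix p q assume "poly_code p = poly_code q"
  then have "map (\<lambda>t. t = 1) (coeffs p) = map (\<lambda>t. t = 1) (coeffs q)"
    by (simp add: poly_code_def)
  moreover have "inj (\<lambda>t :: bit. t = 1)"
    by (rule injI) (metis bit_not_one_iff)
  ultimately show "p = q"
    by (simp add: inj_map_eq_map coeffs_eq_iff)
qed

text \<open>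
The value at \<open>1\<close> determines the elements of a ring with leads, so this code is injective on each
of them, although the set of all operators is uncountable. It names elements independently of the
stage at which they appear.
\<close>

definition endo_code :: "endo \<Rightarrow> nat" where
  "endo_code f = poly_code (app f 1)"

lemma inj_on_endo_code: "lead_ring R W \<Longrightarrow> inj_on endo_code R"
  unfolding endo_code_def by (rule inj_onI) (blast dest: injD[OF inj_poly_code] lead_ring_eqI)

text \<open>
Step \<open>n\<close> treats the equation whose coefficients have the codes recorded in \<open>n\<close>, provided that they
are present. As the component \<open>i\<close> of the task is arbitrary, every equation comes up at arbitrarily
late steps, hence also after both coefficients have appeared.
\<close>

lemma exists_saturated_extension:
  assumes R: "lead_ring R (words k)"
  shows "\<exists>S. R \<subseteq> S \<and> lead_ring S (range word) \<and> (\<forall>x\<in>S. \<forall>a\<in>S. a \<noteq> 0 \<longrightarrow> solves S x a)"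
proof -
  let ?task = "\<lambda>i x a. prod_encode (i, prod_encode (endo_code x, endo_code a))"
  define P where "P n S \<longleftrightarrow> R \<subseteq> S \<and> (\<exists>k. lead_ring S (words k))" for n :: nat and S
  define Q where "Q n S T \<longleftrightarrow> S \<subseteq> T
    \<and> (\<forall>i. \<forall>x\<in>S. \<forall>a\<in>S. n = ?task i x a \<and> a \<noteq> 0 \<longrightarrow> solves T x a)" for n and S T :: "endo set"
  have step: "\<exists>T. P (Suc n) T \<and> Q n S T" if S: "P n S" for n S
  proof (cases "\<exists>i. \<exists>x\<in>S. \<exists>a\<in>S. n = ?task i x a \<and> a \<noteq> 0")
    case False
    then show ?thesis using S by (intro exI[of _ S]) (auto simp: P_def Q_def)
  next
    case True
    then obtain i x a where xa: "x \<in> S" "a \<in> S" "a \<noteq> 0" and n: "n = ?task i x a" by blast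
    obtain l where l: "lead_ring S (words l)" using S by (auto simp: P_def)
    obtain T j b c where T: "S \<subseteq> T" "lead_ring T (words (Suc j))" "b \<in> T" "c \<in> T"
      "x = a * b + c * a"
      using adjoin_solution[OF l xa] by blast
    have "y = x \<and> d = a" if "y \<in> S" "d \<in> S" "n = ?task i' y d" for y d i'
      using that n xa inj_onD[OF inj_on_endo_code[OF l]] by simp
    then have "Q n S T"
      unfolding Q_def solves_def using T by blast
    moreover have "P (Suc n) T" using S T by (auto simp: P_def)
    ultimately show ?thesis by blast
  qed
  have "\<exists>S. P 0 S" using R by (auto simp: P_def)
  then obtain f where f: "\<And>n. P n (f n)" "\<And>n. Q n (f n) (f (Suc n))"
    using dependent_nat_choice[of P Q] step by metis
  have "f n \<subseteq> f (Suc n)" for n using f(2)[of n] by (simp add: Q_def)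
  then have mono: "f m \<subseteq> f n" if "m \<le> n" for m n
    using that by (rule lift_Suc_mono_le)
  define S where "S = (\<Union>n. f n)"
  have fS: "f n \<subseteq> S" for n by (auto simp: S_def)
  have common: "\<exists>n. x \<in> f n \<and> y \<in> f n" if xy: "x \<in> S" "y \<in> S" for x y
  proof -
    obtain m n where "x \<in> f m" "y \<in> f n" using xy by (auto simp: S_def)
    then have "x \<in> f (max m n)" "y \<in> f (max m n)"
      using mono[of m "max m n"] mono[of n "max m n"] by auto
    then show ?thesis by blast
  qed
  have fring: "\<exists>l. lead_ring (f n) (words l)" for n
    using f(1)[of n] by (simp add: P_def)
  have "R \<subseteq> S" using f(1)[of 0] fS[of 0] by (auto simp: P_def)
  moreover have "lead_ring S (range word)"
    unfolding lead_ring_def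
  proof (intro conjI ballI impI)
    show "1 \<in> S" using lead_ringD(1)[OF R] \<open>R \<subseteq> S\<close> by blast
  next
    fix x y assume "x \<in> S" "y \<in> S"
    then obtain n where n: "x \<in> f n" "y \<in> f n" using common by blast
    obtain l where "lead_ring (f n) (words l)" using fring by blast
    from lead_ringD(3,4)[OF this n] show "x + y \<in> S" "x * y \<in> S" using fS by blast+
  next
    fix x assume x: "x \<in> S" "x \<noteq> 0"
    then obtain n where n: "x \<in> f n" using S_def by blast
    obtain l where "lead_ring (f n) (words l)" using fring by blast
    from lead_ringD(5,6)[OF this n x(2)] show "\<exists>m\<in>range word. lead x m"
      unfolding words_def by blast
  qed
  moreover have "solves S x a" if xa: "x \<in> S" "a \<in> S" "a \<noteq> 0" for x a
  proof -
    obtain m where m: "x \<in> f m" "a \<in> f m" using common xa by blast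
    define n where "n = ?task m x a"
    have "m \<le> n" unfolding n_def by (rule le_prod_encode_1)
    then have "x \<in> f n" "a \<in> f n" using mono m by blast+
    then have "solves (f (Suc n)) x a"
      using f(2)[of n] xa(3) unfolding Q_def n_def by blast
    then show ?thesis unfolding solves_def using fS by blast
  qed
  ultimately show ?thesis by blast
qed

section \<open>Independent elements on both sides\<close>

lemma lead_ring_prime_field: "lead_ring {0, 1} (words 0)"
  using lead_one zero_in_words[of 0] by (auto simp: lead_ring_def)

text \<open>
Solving an equation with \<open>a = 1\<close> over the prime field produces an element whose lead is a single
letter. Solving an equation with this element as \<open>a\<close> produces two elements whose leads are the
two products of this letter and a new one.
\<close>

lemma exists_lead_ring_with_swapped_leads:
  "\<exists>R k u v i j. lead_ring R (words k) \<and> u \<in> R \<and> v \<in> R \<and> i \<noteq> j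
     \<and> lead u (word [i, j]) \<and> lead v (word [j, i])"
proof -
  have "ld 1 = 0" by (rule ld_eq) (rule lead_one)
  then obtain R i a where R: "lead_ring R (words (Suc i))" and a: "a \<in> R" "lead a (letter i)"
    using adjoin_solution[OF lead_ring_prime_field, of 0 1] by auto
  have "a \<noteq> 0" "ld a = letter i" using a lead_nonzero ld_eq by blast+
  then obtain R' j u v where "lead_ring R' (words (Suc j))" "Suc i \<le> j" "u \<in> R'" "v \<in> R'"
    "lead u (letter j \<star> letter i)" "lead v (letter i \<star> letter j)"
    using adjoin_solution[OF R a(1) a(1)] by metis
  then show ?thesis
    by (intro exI[of _ R'] exI[of _ "Suc j"] exI[of _ u] exI[of _ v] exI[of _ j] exI[of _ i]) simp
qed

text \<open>
Otherwise one word would start, respectively end, both with \<open>ij\<close> and with \<open>ji\<close>.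
\<close>

lemma independent_if_leads_swapped:
  assumes R: "lead_ring R (range word)" and u: "lead u (word [i, j])" and v: "lead v (word [j, i])"
    and ij: "i \<noteq> j" and r: "r \<in> R" "s \<in> R"
  shows "u * r = v * s \<Longrightarrow> u * r = 0" "r * u = s * v \<Longrightarrow> r * u = 0"
proof -
  have lead_word: "\<exists>w. lead t (word w)" if "t \<in> R" "t \<noteq> 0" for t
    using R that unfolding lead_ring_def by blast
  show "u * r = 0" if eq: "u * r = v * s"
  proof (rule ccontr)
    assume nz: "u * r \<noteq> 0"
    then have "r \<noteq> 0" "s \<noteq> 0" using eq by auto
    then obtain w w' where "lead r (word w)" "lead s (word w')" using lead_word r by blast
    then have "word [i, j] \<star> word w = word [j, i] \<star> word w'"
      using lead_times[OF u] lead_times[OF v] eq lead_unique by metis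
    then have "word ([i, j] @ w) = word ([j, i] @ w')"
      unfolding word_append .
    then show False using ij unfolding word_eq_iff by simp
  qed
  show "r * u = 0" if eq: "r * u = s * v"
  proof (rule ccontr)
    assume nz: "r * u \<noteq> 0"
    then have "r \<noteq> 0" "s \<noteq> 0" using eq by auto
    then obtain w w' where "lead r (word w)" "lead s (word w')" using lead_word r by blast
    then have "word w \<star> word [i, j] = word w' \<star> word [j, i]"
      using lead_times[OF _ u] lead_times[OF _ v] eq lead_unique by metis
    then have "word (w @ [i, j]) = word (w' @ [j, i])"
      unfolding word_append .
    then show False using ij unfolding word_eq_iff by simp
  qed
qed

section \<open>Principal one-sided ideals\<close>

context ring
begin

lemma principal_right_ideal:
  assumes u: "u \<in> carrier R"
  shows "right_ideal ((\<lambda>r. u \<otimes> r) ` carrier R) R"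
proof (intro right_ideal.intro right_ideal_axioms.intro additive_subgroup.intro
    add.subgroupI ring_axioms)
  show "(\<lambda>r. u \<otimes> r) ` carrier R \<noteq> {}" by auto
  show "a \<otimes> x \<in> (\<lambda>r. u \<otimes> r) ` carrier R"
    if "a \<in> (\<lambda>r. u \<otimes> r) ` carrier R" "x \<in> carrier R" for a x
    using that u by (auto simp: m_assoc)
  show "a \<oplus> b \<in> (\<lambda>r. u \<otimes> r) ` carrier R"
    if "a \<in> (\<lambda>r. u \<otimes> r) ` carrier R" "b \<in> (\<lambda>r. u \<otimes> r) ` carrier R" for a b
    using that u by (auto simp: r_distr[symmetric])
  show "\<ominus> a \<in> (\<lambda>r. u \<otimes> r) ` carrier R" if "a \<in> (\<lambda>r. u \<otimes> r) ` carrier R" for a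
    using that u by (auto simp: r_minus[symmetric])
qed (use u in auto)

lemma principal_left_ideal:
  assumes u: "u \<in> carrier R"
  shows "left_ideal ((\<lambda>r. r \<otimes> u) ` carrier R) R"
proof (intro left_ideal.intro left_ideal_axioms.intro additive_subgroup.intro
    add.subgroupI ring_axioms)
  show "(\<lambda>r. r \<otimes> u) ` carrier R \<noteq> {}" by auto
  show "x \<otimes> a \<in> (\<lambda>r. r \<otimes> u) ` carrier R"
    if "a \<in> (\<lambda>r. r \<otimes> u) ` carrier R" "x \<in> carrier R" for a x
    using that u by (auto simp: m_assoc[symmetric])
  show "a \<oplus> b \<in> (\<lambda>r. r \<otimes> u) ` carrier R"
    if "a \<in> (\<lambda>r. r \<otimes> u) ` carrier R" "b \<in> (\<lambda>r. r \<otimes> u) ` carrier R" for a b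
    using that u by (auto simp: l_distr[symmetric])
  show "\<ominus> a \<in> (\<lambda>r. r \<otimes> u) ` carrier R" if "a \<in> (\<lambda>r. r \<otimes> u) ` carrier R" for a
    using that u by (auto simp: l_minus[symmetric])
qed (use u in auto)

lemma not_right_oreI:
  assumes uv: "u \<in> carrier R" "v \<in> carrier R" "u \<noteq> \<zero>" "v \<noteq> \<zero>"
    and indep: "\<And>r s. r \<in> carrier R \<Longrightarrow> s \<in> carrier R \<Longrightarrow> u \<otimes> r = v \<otimes> s \<Longrightarrow> u \<otimes> r = \<zero>"
  shows "\<not> right_ore R"
proof -
  let ?I = "\<lambda>u. (\<lambda>r. u \<otimes> r) ` carrier R"
  have ne: "?I w \<noteq> {\<zero>}" if "w \<in> carrier R" "w \<noteq> \<zero>" for w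
    using that r_one[of w] by (metis imageI one_closed singletonD)
  have "\<zero> \<in> ?I w" if "w \<in> carrier R" for w
    using that r_null[of w] by (metis imageI zero_closed)
  then have "?I u \<inter> ?I v = {\<zero>}"
    using uv indep by blast
  then show ?thesis
    unfolding right_ore_def using principal_right_ideal uv ne by metis
qed

lemma not_left_oreI:
  assumes uv: "u \<in> carrier R" "v \<in> carrier R" "u \<noteq> \<zero>" "v \<noteq> \<zero>"
    and indep: "\<And>r s. r \<in> carrier R \<Longrightarrow> s \<in> carrier R \<Longrightarrow> r \<otimes> u = s \<otimes> v \<Longrightarrow> r \<otimes> u = \<zero>"
  shows "\<not> left_ore R"
proof -
  let ?I = "\<lambda>u. (\<lambda>r. r \<otimes> u) ` carrier R"
  have ne: "?I w \<noteq> {\<zero>}" if "w \<in> carrier R" "w \<noteq> \<zero>" for w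
    using that l_one[of w] by (metis imageI one_closed singletonD)
  have "\<zero> \<in> ?I w" if "w \<in> carrier R" for w
    using that l_null[of w] by (metis imageI zero_closed)
  then have "?I u \<inter> ?I v = {\<zero>}"
    using uv indep by blast
  then show ?thesis
    unfolding left_ore_def using principal_left_ideal uv ne by metis
qed

end

section \<open>Transport to the natural numbers\<close>

definition coded_ring :: "endo set \<Rightarrow> nat ring" where
  "coded_ring S = (let dec = inv_into S endo_code in
    \<lparr>carrier = endo_code ` S, monoid.mult = (\<lambda>i j. endo_code (dec i * dec j)), one = endo_code 1,
     zero = endo_code 0, add = (\<lambda>i j. endo_code (dec i + dec j))\<rparr>)"

lemma coded_ring_simps:
  assumes S: "lead_ring S W"
  shows "carrier (coded_ring S) = endo_code ` S"
    "\<one>\<^bsub>coded_ring S\<^esub> = endo_code 1" "\<zero>\<^bsub>coded_ring S\<^esub> = endo_code 0"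
    "f \<in> S \<Longrightarrow> g \<in> S \<Longrightarrow> endo_code f \<otimes>\<^bsub>coded_ring S\<^esub> endo_code g = endo_code (f * g)"
    "f \<in> S \<Longrightarrow> g \<in> S \<Longrightarrow> endo_code f \<oplus>\<^bsub>coded_ring S\<^esub> endo_code g = endo_code (f + g)"
    "f \<in> S \<Longrightarrow> g \<in> S \<Longrightarrow> endo_code f = endo_code g \<longleftrightarrow> f = g"
  using inj_on_endo_code[OF S] by (auto simp: coded_ring_def Let_def inj_on_eq_iff)

lemma ring_coded_ring:
  assumes S: "lead_ring S W"
  shows "ring (coded_ring S)"
proof -
  note [simp] = coded_ring_simps[OF S] lead_ringD(1-4)[OF S]
  show ?thesis
  proof (intro ringI abelian_groupI monoidI)
    fix x assume "x \<in> carrier (coded_ring S)"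
    then show "\<exists>y\<in>carrier (coded_ring S). y \<oplus>\<^bsub>coded_ring S\<^esub> x = \<zero>\<^bsub>coded_ring S\<^esub>"
      by (intro bexI[of _ x]) auto
  qed (auto simp: algebra_simps)
qed

theorem corollary5:
  shows "\<exists>R :: nat ring. fadelian_ring R \<and> \<not> right_ore R \<and> \<not> left_ore R"
proof -
  obtain R k u v i j where R: "lead_ring R (words k)" "u \<in> R" "v \<in> R"
    and ij: "i \<noteq> j" and u: "lead u (word [i, j])" and v: "lead v (word [j, i])"
    using exists_lead_ring_with_swapped_leads by blast
  obtain S where "R \<subseteq> S" and S: "lead_ring S (range word)"
    and sol: "\<And>x a. x \<in> S \<Longrightarrow> a \<in> S \<Longrightarrow> a \<noteq> 0 \<Longrightarrow> solves S x a"
    using exists_saturated_extension[OF R(1)] by blast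
  then have uv: "u \<in> S" "v \<in> S" using R by auto
  let ?C = "coded_ring S"
  note [simp] = coded_ring_simps[OF S] lead_ringD(1-4)[OF S]
  interpret C: ring ?C by (rule ring_coded_ring[OF S])
  have nz: "u \<noteq> 0" "v \<noteq> 0" using u v lead_nonzero by blast+
  have "fadelian_ring ?C"
  proof
    show "\<one>\<^bsub>?C\<^esub> \<noteq> \<zero>\<^bsub>?C\<^esub>" by simp
    fix x a assume xa: "x \<in> carrier ?C" "a \<in> carrier ?C" "a \<noteq> \<zero>\<^bsub>?C\<^esub>"
    then obtain y d where yd: "x = endo_code y" "a = endo_code d" "y \<in> S" "d \<in> S" "d \<noteq> 0"
      by auto
    then obtain b c where bc: "b \<in> S" "c \<in> S" "y = d * b + c * d"
      using sol[of y d] unfolding solves_def by blast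
    then have "x = a \<otimes>\<^bsub>?C\<^esub> endo_code b \<oplus>\<^bsub>?C\<^esub> endo_code c \<otimes>\<^bsub>?C\<^esub> a"
      using yd by simp
    then show "\<exists>b\<in>carrier ?C. \<exists>c\<in>carrier ?C. x = a \<otimes>\<^bsub>?C\<^esub> b \<oplus>\<^bsub>?C\<^esub> c \<otimes>\<^bsub>?C\<^esub> a"
      using bc by auto
  qed
  moreover have "\<not> right_ore ?C"
  proof (rule C.not_right_oreI[of "endo_code u" "endo_code v"])
    fix r s assume "r \<in> carrier ?C" "s \<in> carrier ?C"
      and "endo_code u \<otimes>\<^bsub>?C\<^esub> r = endo_code v \<otimes>\<^bsub>?C\<^esub> s"
    then show "endo_code u \<otimes>\<^bsub>?C\<^esub> r = \<zero>\<^bsub>?C\<^esub>"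
      using independent_if_leads_swapped(1)[OF S u v ij] uv by auto
  qed (use uv nz in simp_all)
  moreover have "\<not> left_ore ?C"
  proof (rule C.not_left_oreI[of "endo_code u" "endo_code v"])
    fix r s assume "r \<in> carrier ?C" "s \<in> carrier ?C"
      and "r \<otimes>\<^bsub>?C\<^esub> endo_code u = s \<otimes>\<^bsub>?C\<^esub> endo_code v"
    then show "r \<otimes>\<^bsub>?C\<^esub> endo_code u = \<zero>\<^bsub>?C\<^esub>"
      using independent_if_leads_swapped(2)[OF S u v ij] uv by auto
  qed (use uv nz in simp_all)
  ultimately show ?thesis by blast
qed

end
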